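(* Let $d\ge 1$, $M>0$, and let $D\subset\mathbb Z^d$ be a Delone set (i.e. an $R$-Delone set for some $R\ge 1$). On $\ell^2(\mathbb Z^d)$ let $$\tilde H_0=\Delta+4d+V_0,\qquad V_0=M\sum_{n\in\mathbb Z^d\setminus D}\delta_n,\qquad \tilde H_\omega=\tilde H_0+\tilde V_\omega,\qquad \tilde V_\omega=\sum_{n\in D}\tilde\omega(n)\delta_n,$$ where $(\tilde\omega(n))_{n\in D}$ are i.i.d. random variables with distribution $\tilde\mu$, $\operatorname{supp}\tilde\mu\subset[0,M]$. Let $0\in\operatorname{supp}\tilde\mu$ and assume that $D$ has the property of strict uniform pattern frequency. Then $$\sigma(\tilde H_0)\subset\sigma(\tilde H_\omega)\quad\text{almost surely.}$$
   Context: **Delone sets.** For a constant $R\ge 1$, a subset $D\subset\mathbb Z^d$ is an $R$-Delone set in $\mathbb Z^d$ if every closed cube in $\mathbb Z^d$ of side length $R$ in the max-norm contains at least one point of $D$. **Strict uniform pattern frequency.** Any finite subset $Q\subset D$ is called a pattern of $D$; two sets $Q,Q'\subset D$ are equivalent if $x+Q=Q'$ for some $x\in\mathbb Z^d$. Let $(\Lambda_L)_{L\in\mathbb N}$ be a sequence of concentric cubes of side length $L$ in $\mathbb Z^d$. $D$ has uniform pattern frequency if for any pattern $Q\subset D$ the sequence $$\eta_{x,L}(Q)=\frac{\#\{\tilde Q\subset D:\ \exists\, y\in x+\Lambda_L \text{ such that } y+\tilde Q=Q\}}{|\Lambda_L|}$$ converges uniformly with respect to $x\in\mathbb Z^d$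 as $L\to\infty$. It has strict uniform pattern frequency if moreover this limit is strictly positive. **Operators.** $(\Delta u)(n)=\sum_{|m-n|_1=1}(u(m)-u(n))$, where $|n|_1=\sum_i|n_i|$; $\delta_n$ denotes the Kronecker delta at $n$, and functions on $\mathbb Z^d$ act as multiplication operators. Here $\tilde\omega(n)=M-\omega(n)$, where $(\omega(n))_{n\in D}$ are i.i.d. with regular, compactly supported distribution $\mu$, $\operatorname{supp}\mu\subset[0,M]$; with $H_\omega=-\Delta+\sum_{n\in D}\omega(n)\delta_n$ one has $\tilde H_\omega=-H_\omega+4d+M$.
   Formalization: Patterns are nonempty sets D∩W with W a finite window, and an occurrence must equal all of D in the translated window; with the frequency defined by arbitrary finite Q⊂D the claim fails, e.g. for D=Z∖{0}, M=10, uniform law on [0,1]. *)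

theory Defs
  imports "HOL-Probability.Probability"
begin

section \<open>The lattice and Delone sets\<close>

definition l1_norm :: "int ^ 'd \<Rightarrow> int" where
  "l1_norm n = (\<Sum>i\<in>UNIV. \<bar>n $ i\<bar>)"

definition max_norm :: "int ^ 'd \<Rightarrow> int" where
  "max_norm n = Max (range (\<lambda>i. \<bar>n $ i\<bar>))"

definition cube :: "int ^ 'd \<Rightarrow> real \<Rightarrow> (int ^ 'd) set" where
  "cube c s = {n. real_of_int (max_norm (n - c)) \<le> s / 2}"

definition delone :: "real \<Rightarrow> (int ^ 'd) set \<Rightarrow> bool" where
  "delone R D \<longleftrightarrow> R \<ge> 1 \<and> (\<forall>c. cube c R \<inter> D \<noteq> {})"


section \<open>Pattern frequencies\<close>

text \<open>
  A pattern is a finite set \<open>Q = D \<inter> W\<close>, recorded together with a finite window \<open>W\<close> in which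
  it is seen. A set \<open>Q'\<close> with \<open>y + Q' = Q\<close> counts as an occurrence of the pattern if it is all
  that \<open>D\<close> has in the correspondingly translated window \<open>W - y\<close>. For \<open>W = Q\<close> this last condition
  only says \<open>Q' \<subseteq> D\<close>, so every finite subset of \<open>D\<close> is covered, with the plain count of its
  translates inside \<open>D\<close> (lemma \<open>pattern_freq_subset\<close>).

  Plain counts for \<open>W = Q\<close> alone would not see holes: all finite nonempty subsets of
  \<open>D = \<int> - {0}\<close> have plain frequency \<open>1\<close>, although the hole at \<open>0\<close> never recurs, and
  spectral inclusions fail for this \<open>D\<close>. (Take \<open>M = 10\<close> and the uniform distribution on
  \<open>[0, 1]\<close>: the eigenvalue \<open>2 + sqrt 104\<close> of the unperturbed operator almost surely moves up.)
\<close>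

definition pattern_freq ::
    "(int ^ 'd) set \<Rightarrow> (int ^ 'd) set \<Rightarrow> int ^ 'd \<Rightarrow> nat \<Rightarrow> real" where
  "pattern_freq D W x L =
     real (card {Q'. Q' \<subseteq> D \<and>
       (\<exists>y \<in> (+) x ` cube 0 (real L). (+) y ` Q' = D \<inter> W \<and> Q' = D \<inter> (+) (- y) ` W)})
     / real (card (cube (0 :: int ^ 'd) (real L)))"

lemma pattern_freq_subset:
  fixes D Q :: "(int ^ 'd) set"
  assumes "Q \<subseteq> D"
  shows "pattern_freq D Q x L =
     real (card {Q'. Q' \<subseteq> D \<and> (\<exists>y \<in> (+) x ` cube 0 (real L). (+) y ` Q' = Q)})
     / real (card (cube (0 :: int ^ 'd) (real L)))"
proof -
  have Q: "D \<inter> Q = Q"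
    using assms by blast
  have eq: "Q' = D \<inter> (+) (- y) ` Q" if "Q' \<subseteq> D" "(+) y ` Q' = Q" for Q' y
  proof -
    have "(+) (- y) ` Q = Q'"
      by (simp add: that(2) [symmetric] image_image)
    then show ?thesis
      using that(1) by blast
  qed
  have "{Q'. Q' \<subseteq> D \<and> (\<exists>y \<in> (+) x ` cube 0 (real L). (+) y ` Q' = Q \<and> Q' = D \<inter> (+) (- y) ` Q)}
      = {Q'. Q' \<subseteq> D \<and> (\<exists>y \<in> (+) x ` cube 0 (real L). (+) y ` Q' = Q)}"
    using eq by blast
  then show ?thesis
    by (simp only: pattern_freq_def Q)
qed

text \<open>
  The empty pattern is excluded: its only occurrence is the empty set, so its count is \<open>1\<close> and
  its frequency tends to \<open>0\<close> for every \<open>D\<close>.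
\<close>

definition uniform_pattern_frequency :: "(int ^ 'd) set \<Rightarrow> bool" where
  "uniform_pattern_frequency D \<longleftrightarrow>
     (\<forall>W. finite W \<and> D \<inter> W \<noteq> {} \<longrightarrow>
        uniformly_convergent_on UNIV (\<lambda>L x. pattern_freq D W x L))"

definition strict_uniform_pattern_frequency :: "(int ^ 'd) set \<Rightarrow> bool" where
  "strict_uniform_pattern_frequency D \<longleftrightarrow>
     uniform_pattern_frequency D \<and>
     (\<forall>W. finite W \<and> D \<inter> W \<noteq> {} \<longrightarrow> (\<forall>x. 0 < lim (\<lambda>L. pattern_freq D W x L)))"


section \<open>Spectra of bounded operators on square-summable functions\<close>

definition ell2 :: "('a \<Rightarrow> complex) set" where
  "ell2 = {u. (\<lambda>n. (cmod (u n))\<^sup>2) summable_on UNIV}"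

definition ell2_norm :: "('a \<Rightarrow> complex) \<Rightarrow> real" where
  "ell2_norm u = sqrt (\<Sum>\<^sub>\<infinity>n. (cmod (u n))\<^sup>2)"

definition bounded_operator :: "(('a \<Rightarrow> complex) \<Rightarrow> ('a \<Rightarrow> complex)) \<Rightarrow> bool" where
  "bounded_operator T \<longleftrightarrow>
     (\<forall>u\<in>ell2. T u \<in> ell2) \<and>
     (\<forall>u\<in>ell2. \<forall>v\<in>ell2. T (\<lambda>n. u n + v n) = (\<lambda>n. T u n + T v n)) \<and>
     (\<forall>c. \<forall>u\<in>ell2. T (\<lambda>n. c * u n) = (\<lambda>n. c * T u n)) \<and>
     (\<exists>C. \<forall>u\<in>ell2. ell2_norm (T u) \<le> C * ell2_norm u)"

text \<open>
  Only the restriction of \<open>T\<close> to \<^const>\<open>ell2\<close> matters; the notion is meant for bounded operators.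
\<close>

definition spectrum :: "(('a \<Rightarrow> complex) \<Rightarrow> ('a \<Rightarrow> complex)) \<Rightarrow> complex set" where
  "spectrum T = {z. \<not> (\<exists>S. bounded_operator S \<and>
     (\<forall>u\<in>ell2. S (\<lambda>n. T u n - z * u n) = u \<and> (\<lambda>n. T (S u) n - z * S u n) = u))}"


section \<open>The operators\<close>

definition laplacian :: "(int ^ 'd \<Rightarrow> complex) \<Rightarrow> (int ^ 'd \<Rightarrow> complex)" where
  "laplacian u n = (\<Sum>m | l1_norm (m - n) = 1. u m - u n)"

definition V0 :: "real \<Rightarrow> (int ^ 'd) set \<Rightarrow> int ^ 'd \<Rightarrow> real" where
  "V0 M D n = M * indicator (- D) n"

definition H0 :: "real \<Rightarrow> (int ^ 'd) set \<Rightarrow> (int ^ 'd \<Rightarrow> complex) \<Rightarrow> (int ^ 'd \<Rightarrow> complex)" where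
  "H0 M D u n =
     laplacian u n + 4 * of_nat CARD('d) * u n + complex_of_real (V0 M D n) * u n"

definition V_random :: "(int ^ 'd) set \<Rightarrow> (int ^ 'd \<Rightarrow> real) \<Rightarrow> int ^ 'd \<Rightarrow> real" where
  "V_random D w n = w n * indicator D n"

definition H_random ::
    "real \<Rightarrow> (int ^ 'd) set \<Rightarrow> (int ^ 'd \<Rightarrow> real) \<Rightarrow> (int ^ 'd \<Rightarrow> complex) \<Rightarrow> (int ^ 'd \<Rightarrow> complex)" where
  "H_random M D w u n = H0 M D u n + complex_of_real (V_random D w n) * u n"


section \<open>Support of a distribution\<close>

definition measure_support :: "real measure \<Rightarrow> real set" where
  "measure_support \<mu> = {x. \<forall>U. open U \<and> x \<in> U \<longrightarrow> emeasure \<mu> U > 0}"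

end

theory Submission
  imports Defs "HOL-Real_Asymp.Real_Asymp"
begin

text \<open>
  Let \<open>z\<close> be outside the spectrum of \<open>H_random\<close>, so that \<open>\<parallel>u\<parallel> \<le> C \<parallel>(H_random - z) u\<parallel>\<close>. Strict
  pattern frequency makes the configuration of \<open>D\<close> in any finite window recur infinitely often,
  hence in infinitely many disjoint places, and by independence almost surely the random potential
  is uniformly small in one of them. There \<open>H_random\<close> is close to a translate of \<open>H0\<close>, so the
  bound passes to \<open>H0 - z\<close> on finitely supported \<open>u\<close> and by density on \<open>\<ell>\<^sup>2\<close>. As \<open>H0 - z\<close> is
  normal, being bounded below implies invertibility. Only countably many windows and tolerances
  are needed, so the exceptional null set does not depend on \<open>z\<close>.
\<close>

section \<open>Square-summable functions\<close>

lemma L2_set_le_ell2_norm: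
  assumes "u \<in> ell2" "finite F"
  shows "L2_set (\<lambda>n. cmod (u n)) F \<le> ell2_norm u"
  unfolding L2_set_def ell2_norm_def
  using assms by (intro real_sqrt_le_mono finite_sum_le_infsum) (auto simp: ell2_def)

text \<open>Reduces estimates in \<open>ell2\<close> to the inequalities for finite
  \<open>L2_set\<close> sums: one uniform bound yields both membership and the norm estimate. The
  empty set forces \<open>B\<close> to be nonnegative, which permits squaring.\<close>

lemma ell2_boundI:
  assumes "\<And>F. finite F \<Longrightarrow> L2_set (\<lambda>n. cmod (u n)) F \<le> B"
  shows "u \<in> ell2" and "ell2_norm u \<le> B"
proof -
  have B0: "0 \<le> B"
    using assms[of "{}"] by simp
  have le: "(\<Sum>n\<in>F. (cmod (u n))\<^sup>2) \<le> B\<^sup>2" if "finite F" for F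
    using assms[OF that] B0 unfolding L2_set_def by (simp add: sqrt_le_D)
  then have sm: "(\<lambda>n. (cmod (u n))\<^sup>2) summable_on UNIV"
    by (intro nonneg_bdd_above_summable_on bdd_aboveI) auto
  then show "u \<in> ell2"
    by (simp add: ell2_def)
  have "(\<Sum>\<^sub>\<infinity>n. (cmod (u n))\<^sup>2) \<le> B\<^sup>2"
    using sm le by (intro infsum_le_finite_sums) auto
  then show "ell2_norm u \<le> B"
    unfolding ell2_norm_def using B0 real_le_lsqrt by blast
qed

lemma ell2_norm_nonneg [simp]: "0 \<le> ell2_norm u"
  by (simp add: ell2_norm_def infsum_nonneg)

lemma cmod_le_ell2_norm: "u \<in> ell2 \<Longrightarrow> cmod (u n) \<le> ell2_norm u"
  using L2_set_le_ell2_norm[of u "{n}"] by simp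

lemma ell2_norm_eq_0: "u \<in> ell2 \<Longrightarrow> ell2_norm u = 0 \<Longrightarrow> u = (\<lambda>n. 0)"
  by (metis cmod_le_ell2_norm norm_le_zero_iff)

lemma
  assumes "u \<in> ell2" "v \<in> ell2"
  shows ell2_add: "(\<lambda>n. u n + v n) \<in> ell2"
    and ell2_norm_triangle: "ell2_norm (\<lambda>n. u n + v n) \<le> ell2_norm u + ell2_norm v"
proof -
  have *: "L2_set (\<lambda>n. cmod (u n + v n)) F \<le> ell2_norm u + ell2_norm v" if "finite F" for F
  proof -
    have "L2_set (\<lambda>n. cmod (u n + v n)) F \<le> L2_set (\<lambda>n. cmod (u n) + cmod (v n)) F"
      by (intro L2_set_mono norm_triangle_ineq) auto
    also have "\<dots> \<le> L2_set (\<lambda>n. cmod (u n)) F + L2_set (\<lambda>n. cmod (v n)) F"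
      by (rule L2_set_triangle_ineq)
    also have "\<dots> \<le> ell2_norm u + ell2_norm v"
      using assms that by (intro add_mono L2_set_le_ell2_norm)
    finally show ?thesis .
  qed
  show "(\<lambda>n. u n + v n) \<in> ell2"
    using * by (rule ell2_boundI(1))
  show "ell2_norm (\<lambda>n. u n + v n) \<le> ell2_norm u + ell2_norm v"
    using * by (rule ell2_boundI(2))
qed

text \<open>Multiplication by a bounded function is the intended case: scalars and potentials are
  both handled by pointwise domination.\<close>

lemma
  assumes "u \<in> ell2" "0 \<le> K" "\<And>n. cmod (v n) \<le> K * cmod (u n)"
  shows ell2_dominated: "v \<in> ell2"
    and ell2_norm_dominated: "ell2_norm v \<le> K * ell2_norm u"
proof -
  have *: "L2_set (\<lambda>n. cmod (v n)) F \<le> K * ell2_norm u" if "finite F" for F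
  proof -
    have "L2_set (\<lambda>n. cmod (v n)) F \<le> L2_set (\<lambda>n. K * cmod (u n)) F"
      using assms by (intro L2_set_mono) auto
    also have "\<dots> = K * L2_set (\<lambda>n. cmod (u n)) F"
      by (simp add: L2_set_left_distrib L2_set_right_distrib assms)
    also have "\<dots> \<le> K * ell2_norm u"
      using assms that by (intro mult_left_mono L2_set_le_ell2_norm)
    finally show ?thesis .
  qed
  show "v \<in> ell2"
    using * by (rule ell2_boundI(1))
  show "ell2_norm v \<le> K * ell2_norm u"
    using * by (rule ell2_boundI(2))
qed

lemma ell2_scale: "u \<in> ell2 \<Longrightarrow> (\<lambda>n. c * u n) \<in> ell2"
  by (rule ell2_dominated[of u "cmod c"]) (auto simp: norm_mult)

lemma ell2_norm_scale_le: "u \<in> ell2 \<Longrightarrow> ell2_norm (\<lambda>n. c * u n) \<le> cmod c * ell2_norm u"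
  by (rule ell2_norm_dominated[of u "cmod c"]) (auto simp: norm_mult)

lemma ell2_diff: "u \<in> ell2 \<Longrightarrow> v \<in> ell2 \<Longrightarrow> (\<lambda>n. u n - v n) \<in> ell2"
  using ell2_add[of u "\<lambda>n. (-1) * v n"] ell2_scale[of v "-1"] by simp

lemma ell2_norm_diff_le:
  "u \<in> ell2 \<Longrightarrow> v \<in> ell2 \<Longrightarrow> ell2_norm (\<lambda>n. u n - v n) \<le> ell2_norm u + ell2_norm v"
  using ell2_norm_triangle[of u "\<lambda>n. (-1) * v n"] ell2_scale[of v "-1"]
    ell2_norm_scale_le[of v "-1"] by simp

lemma ell2_norm_diff_commute: "ell2_norm (\<lambda>n. u n - v n) = ell2_norm (\<lambda>n. v n - u n)"
  by (simp add: ell2_norm_def norm_minus_commute)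

lemma ell2_norm_le_diff:
  assumes "u \<in> ell2" "v \<in> ell2"
  shows "ell2_norm u \<le> ell2_norm v + ell2_norm (\<lambda>n. u n - v n)"
  using ell2_norm_triangle[OF assms(2) ell2_diff[OF assms]] by simp

lemma ell2_zero [simp]: "(\<lambda>n. 0) \<in> ell2"
  by (rule ell2_boundI[of _ 0]) (simp add: L2_set_def)

lemma ell2_norm_zero [simp]: "ell2_norm (\<lambda>n. 0) = 0"
  by (simp add: ell2_norm_def)

lemma ell2_sum:
  assumes "finite A" "\<And>a. a \<in> A \<Longrightarrow> f a \<in> ell2"
  shows "(\<lambda>n. \<Sum>a\<in>A. f a n) \<in> ell2"
  using assms by (induction A rule: finite_induct) (auto intro: ell2_add)

lemma ell2_norm_sum_le:
  assumes "finite A" "\<And>a. a \<in> A \<Longrightarrow> f a \<in> ell2"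
  shows "ell2_norm (\<lambda>n. \<Sum>a\<in>A. f a n) \<le> (\<Sum>a\<in>A. ell2_norm (f a))"
  using assms
proof (induction A rule: finite_induct)
  case (insert a A)
  have "ell2_norm (\<lambda>n. f a n + (\<Sum>a\<in>A. f a n)) \<le> ell2_norm (f a) + ell2_norm (\<lambda>n. \<Sum>a\<in>A. f a n)"
    using insert by (intro ell2_norm_triangle ell2_sum) auto
  then show ?case
    using insert by auto
qed simp

lemma ell2_finite_support:
  assumes "finite F" "\<And>n. n \<notin> F \<Longrightarrow> u n = 0"
  shows "u \<in> ell2"
proof -
  have "(\<lambda>n. (cmod (u n))\<^sup>2) summable_on UNIV \<longleftrightarrow> (\<lambda>n. (cmod (u n))\<^sup>2) summable_on F"
    by (rule summable_on_cong_neutral) (use assms in auto)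
  then show ?thesis
    using assms by (simp add: ell2_def)
qed

lemma
  assumes "bij \<pi>"
  shows ell2_reindex: "u \<in> ell2 \<Longrightarrow> (\<lambda>n. u (\<pi> n)) \<in> ell2"
    and ell2_norm_reindex: "ell2_norm (\<lambda>n. u (\<pi> n)) = ell2_norm u"
proof -
  show "ell2_norm (\<lambda>n. u (\<pi> n)) = ell2_norm u"
    unfolding ell2_norm_def using infsum_reindex_bij_betw[OF assms, of "\<lambda>n. (cmod (u n))\<^sup>2"]
    by simp
  show "(\<lambda>n. u (\<pi> n)) \<in> ell2" if "u \<in> ell2"
    using that summable_on_reindex_bij_betw[OF assms, of "\<lambda>n. (cmod (u n))\<^sup>2"]
    by (simp add: ell2_def)
qed

section \<open>Density of finitely supported functions, completeness and contractions\<close>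

lemma ell2_finite_approx:
  assumes "u \<in> ell2" "\<delta> > 0"
  obtains F where "finite F" "ell2_norm (\<lambda>n. u n - (if n \<in> F then u n else 0)) \<le> \<delta>"
proof -
  let ?f = "\<lambda>n. (cmod (u n))\<^sup>2"
  have sm: "?f summable_on UNIV"
    using assms by (simp add: ell2_def)
  obtain F where F: "finite F" "dist (sum ?f F) (infsum ?f UNIV) \<le> \<delta>\<^sup>2"
    using infsum_finite_approximation[OF sm, of "\<delta>\<^sup>2"] assms by auto
  have "infsum (\<lambda>n. (cmod (u n - (if n \<in> F then u n else 0)))\<^sup>2) UNIV = infsum ?f (- F)"
    by (rule infsum_cong_neutral) auto
  also have "\<dots> = infsum ?f UNIV - infsum ?f F"
    using F sm by (simp add: Compl_eq_Diff_UNIV infsum_Diff)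
  also have "\<dots> \<le> \<delta>\<^sup>2"
    using F by (simp add: dist_real_def)
  finally have "ell2_norm (\<lambda>n. u n - (if n \<in> F then u n else 0)) \<le> \<delta>"
    unfolding ell2_norm_def using assms by (intro real_le_lsqrt) auto
  then show thesis
    using that F by blast
qed

text \<open>Completeness in the form needed for a contraction argument. Norms dominate coordinates,
  so pointwise limits exist; the geometric tail bound then passes to the limit over finite
  sets.\<close>

lemma ell2_complete_geometric:
  assumes s: "\<And>N. s N \<in> ell2" and q: "0 \<le> q" "q < 1"
    and step: "\<And>N. ell2_norm (\<lambda>n. s (Suc N) n - s N n) \<le> C * q ^ N"
  obtains u where "u \<in> ell2" "\<And>N. ell2_norm (\<lambda>n. u n - s N n) \<le> C * q ^ N / (1 - q)"
proof -
  have C0: "0 \<le> C"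
    using order_trans[OF ell2_norm_nonneg step[of 0]] by simp
  have dist: "ell2_norm (\<lambda>n. s (N + m) n - s N n) \<le> C * q ^ N * (\<Sum>k<m. q ^ k)" for N m
  proof (induction m)
    case (Suc m)
    have "ell2_norm (\<lambda>n. (s (Suc (N + m)) n - s (N + m) n) + (s (N + m) n - s N n))
        \<le> ell2_norm (\<lambda>n. s (Suc (N + m)) n - s (N + m) n) + ell2_norm (\<lambda>n. s (N + m) n - s N n)"
      by (intro ell2_norm_triangle ell2_diff s)
    also have "\<dots> \<le> C * q ^ (N + m) + C * q ^ N * (\<Sum>k<m. q ^ k)"
      by (intro add_mono step Suc.IH)
    finally show ?case
      by (simp add: algebra_simps power_add)
  qed simp
  have dist': "ell2_norm (\<lambda>n. s (N + m) n - s N n) \<le> C * q ^ N / (1 - q)" for N m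
  proof -
    have "(\<Sum>k<m. q ^ k) \<le> 1 / (1 - q)"
      using q by (simp add: sum_gp_strict divide_right_mono)
    then have "C * q ^ N * (\<Sum>k<m. q ^ k) \<le> C * q ^ N * (1 / (1 - q))"
      using C0 q by (intro mult_left_mono) auto
    then show ?thesis
      using dist[of N m] by simp
  qed
  have "convergent (\<lambda>N. s N n)" for n
  proof -
    have le: "cmod (s (Suc k) n - s k n) \<le> C * q ^ k" for k
      by (rule order_trans[OF cmod_le_ell2_norm[OF ell2_diff[OF s s]] step])
    have "summable (\<lambda>k. C * q ^ k)"
      using q by (intro summable_mult summable_geometric) auto
    then have "summable (\<lambda>k. s (Suc k) n - s k n)"
      by (rule summable_comparison_test'[where N = 0]) (rule le)
    then have "convergent (\<lambda>m. s m n - s 0 n)"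
      unfolding summable_iff_convergent sum_lessThan_telescope[of "\<lambda>m. s m n"] .
    then show ?thesis
      by (simp add: convergent_diff_const_right_iff)
  qed
  then obtain u where u: "\<And>n. (\<lambda>N. s N n) \<longlonglongrightarrow> u n"
    unfolding convergent_def by metis
  \<comment> \<open>With \<open>N\<close> and the finite set \<open>F\<close> fixed,
    \<open>m\<close> tends to infinity: a finite \<open>L2_set\<close> is continuous in its
    coordinates, so the bound \<open>dist'\<close> survives.\<close>
  have L2: "L2_set (\<lambda>n. cmod (u n - s N n)) F \<le> C * q ^ N / (1 - q)" if "finite F" for N F
  proof (rule LIMSEQ_le_const2)
    have "(\<lambda>m. s (N + m) n) \<longlonglongrightarrow> u n" for n
      using LIMSEQ_ignore_initial_segment[OF u, of N n] by (simp add: add.commute)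
    then show "(\<lambda>m. L2_set (\<lambda>n. cmod (s (N + m) n - s N n)) F)
        \<longlonglongrightarrow> L2_set (\<lambda>n. cmod (u n - s N n)) F"
      unfolding L2_set_def by (intro tendsto_intros)
    show "\<exists>N'. \<forall>m\<ge>N'. L2_set (\<lambda>n. cmod (s (N + m) n - s N n)) F \<le> C * q ^ N / (1 - q)"
      using L2_set_le_ell2_norm[OF ell2_diff[OF s s] that] dist' order_trans by blast
  qed
  have "(\<lambda>n. (u n - s 0 n) + s 0 n) \<in> ell2"
    by (intro ell2_add s ell2_boundI(1)[OF L2])
  then have "u \<in> ell2"
    by simp
  then show thesis
    using that ell2_boundI(2)[OF L2] by blast
qed

text \<open>Banach iteration \<open>s (Suc N) = B (s N) + f\<close> started at \<open>f\<close>.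
  Compatibility of \<open>B\<close> with differences makes each increment the image under
  \<open>B\<close> of the previous one, so increments decay geometrically.\<close>

lemma ell2_affine_fixpoint:
  assumes B: "\<And>u. u \<in> ell2 \<Longrightarrow> B u \<in> ell2"
    and B_diff: "\<And>u v. u \<in> ell2 \<Longrightarrow> v \<in> ell2 \<Longrightarrow> B (\<lambda>n. u n - v n) = (\<lambda>n. B u n - B v n)"
    and q: "0 \<le> q" "q < 1"
    and contr: "\<And>u. u \<in> ell2 \<Longrightarrow> ell2_norm (B u) \<le> q * ell2_norm u"
    and f: "f \<in> ell2"
  obtains u where "u \<in> ell2" "u = (\<lambda>n. B u n + f n)"
proof -
  define s where "s = rec_nat f (\<lambda>_ v n. B v n + f n)"
  have s_Suc: "s (Suc N) = (\<lambda>n. B (s N) n + f n)" for N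
    by (simp add: s_def)
  have s: "s N \<in> ell2" for N
    by (induction N) (auto simp: s_def intro!: ell2_add B f)
  define C where "C = ell2_norm (\<lambda>n. s (Suc 0) n - s 0 n)"
  have step: "ell2_norm (\<lambda>n. s (Suc N) n - s N n) \<le> C * q ^ N" for N
  proof (induction N)
    case (Suc N)
    have "ell2_norm (\<lambda>n. s (Suc (Suc N)) n - s (Suc N) n) = ell2_norm (B (\<lambda>n. s (Suc N) n - s N n))"
      using B_diff[OF s s, of "Suc N" N] by (simp add: s_Suc[of N] s_Suc[of "Suc N"])
    also have "\<dots> \<le> q * ell2_norm (\<lambda>n. s (Suc N) n - s N n)"
      by (intro contr ell2_diff s)
    also have "\<dots> \<le> q * (C * q ^ N)"
      using q Suc by (intro mult_left_mono)
    finally show ?case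
      by (simp add: algebra_simps)
  qed (simp add: C_def)
  obtain u where u: "u \<in> ell2"
    and lim: "\<And>N. ell2_norm (\<lambda>n. u n - s N n) \<le> C * q ^ N / (1 - q)"
    using ell2_complete_geometric[OF s q step] by blast
  let ?r = "\<lambda>n. u n - (B u n + f n)"
  have r: "?r \<in> ell2"
    by (intro ell2_diff ell2_add u B f)
  have bound: "ell2_norm ?r \<le> 2 * C / (1 - q) * q ^ N" for N
  proof -
    \<comment> \<open>Inserting \<open>s (Suc N) = B (s N) + f\<close> splits the residual into two
      terms that are small because \<open>s N\<close> approaches \<open>u\<close>.\<close>
    have "?r = (\<lambda>n. (u n - s (Suc N) n) - B (\<lambda>n. u n - s N n) n)"
      using B_diff[OF u s] by (auto simp: s_Suc)
    then have "ell2_norm ?r \<le> ell2_norm (\<lambda>n. u n - s (Suc N) n) + ell2_norm (B (\<lambda>n. u n - s N n))"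
      using ell2_norm_diff_le[OF ell2_diff[OF u s] B[OF ell2_diff[OF u s]]] by simp
    also have "\<dots> \<le> C * q ^ Suc N / (1 - q) + q * (C * q ^ N / (1 - q))"
      using contr[OF ell2_diff[OF u s], of N] mult_left_mono[OF lim[of N] q(1)]
      by (intro add_mono lim) linarith
    also have "\<dots> = q * (2 * C / (1 - q) * q ^ N)"
      by (simp add: algebra_simps add_divide_distrib)
    also have "\<dots> \<le> 1 * (2 * C / (1 - q) * q ^ N)"
      using q by (intro mult_right_mono) (auto simp: C_def)
    finally show ?thesis
      by simp
  qed
  have "(\<lambda>N. 2 * C / (1 - q) * q ^ N) \<longlonglongrightarrow> 2 * C / (1 - q) * 0"
    using q by (intro tendsto_intros LIMSEQ_power_zero) auto
  then have "ell2_norm ?r \<le> 0"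
    using bound by (intro LIMSEQ_le_const) auto
  then have "?r = (\<lambda>n. 0)"
    using ell2_norm_eq_0[OF r] ell2_norm_nonneg by (meson order_antisym)
  then have "u = (\<lambda>n. B u n + f n)"
    by (simp add: fun_eq_iff)
  then show thesis
    using that u by blast
qed

section \<open>Invertibility of normal operators that are bounded below\<close>

text \<open>
  \<open>\<bullet>\<close> is the real inner product of \<open>complex\<close>, so this is the real part of the Hermitian product;
  adjoints with respect to the two coincide.
\<close>

definition ell2_inner :: "('a \<Rightarrow> complex) \<Rightarrow> ('a \<Rightarrow> complex) \<Rightarrow> real" where
  "ell2_inner u v = (\<Sum>\<^sub>\<infinity>n. u n \<bullet> v n)"

lemma ell2_inner_summable:
  assumes "u \<in> ell2" "v \<in> ell2"
  shows "(\<lambda>n. u n \<bullet> v n) summable_on UNIV"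
proof -
  have "(\<lambda>n. (cmod (u n))\<^sup>2 + (cmod (v n))\<^sup>2) summable_on UNIV"
    using assms by (intro summable_on_add) (auto simp: ell2_def)
  moreover have "norm (u n \<bullet> v n) \<le> (cmod (u n))\<^sup>2 + (cmod (v n))\<^sup>2" for n
  proof -
    have "norm (u n \<bullet> v n) \<le> cmod (u n) * cmod (v n)"
      using Cauchy_Schwarz_ineq2 by auto
    moreover have "0 \<le> (cmod (u n) - cmod (v n))\<^sup>2" "0 \<le> cmod (u n) * cmod (v n)"
      by simp_all
    ultimately show ?thesis
      by (simp add: power2_eq_square algebra_simps)
  qed
  ultimately have "(\<lambda>n. norm (u n \<bullet> v n)) summable_on UNIV"
    by (rule summable_on_comparison_test) auto
  then show ?thesis
    by (rule abs_summable_summable)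
qed

lemma ell2_inner_commute: "ell2_inner u v = ell2_inner v u"
  by (simp add: ell2_inner_def inner_commute)

lemma ell2_inner_self: "ell2_inner u u = (ell2_norm u)\<^sup>2"
  by (simp add: ell2_inner_def ell2_norm_def power2_norm_eq_inner infsum_nonneg)

lemma ell2_inner_add_left:
  "u \<in> ell2 \<Longrightarrow> v \<in> ell2 \<Longrightarrow> w \<in> ell2 \<Longrightarrow>
    ell2_inner (\<lambda>n. u n + v n) w = ell2_inner u w + ell2_inner v w"
  unfolding ell2_inner_def inner_add_left by (intro infsum_add ell2_inner_summable)

lemma ell2_inner_add_right:
  "u \<in> ell2 \<Longrightarrow> v \<in> ell2 \<Longrightarrow> w \<in> ell2 \<Longrightarrow>
    ell2_inner w (\<lambda>n. u n + v n) = ell2_inner w u + ell2_inner w v"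
  unfolding ell2_inner_def inner_add_right by (intro infsum_add ell2_inner_summable)

text \<open>The reason why \<open>H - cnj z\<close> is the adjoint of \<open>H - z\<close> for
  symmetric \<open>H\<close>, also when only the real part of the Hermitian product is kept.\<close>

lemma ell2_inner_scale_adjoint: "ell2_inner (\<lambda>n. c * u n) v = ell2_inner u (\<lambda>n. cnj c * v n)"
  unfolding ell2_inner_def by (rule infsum_cong) (simp add: inner_complex_def algebra_simps)

lemma ell2_inner_diff_left:
  assumes "u \<in> ell2" "v \<in> ell2" "w \<in> ell2"
  shows "ell2_inner (\<lambda>n. u n - v n) w = ell2_inner u w - ell2_inner v w"
  using ell2_inner_add_left[OF ell2_diff[OF assms(1,2)] assms(2,3)] by simp

lemma ell2_inner_diff_right:
  assumes "u \<in> ell2" "v \<in> ell2" "w \<in> ell2"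
  shows "ell2_inner w (\<lambda>n. u n - v n) = ell2_inner w u - ell2_inner w v"
  using ell2_inner_diff_left[OF assms] by (simp add: ell2_inner_commute)

lemma ell2_inner_scaleR_right:
  "ell2_inner u (\<lambda>n. complex_of_real t * v n) = t * ell2_inner u v"
proof -
  have "u n \<bullet> (complex_of_real t * v n) = t * (u n \<bullet> v n)" for n
    by (simp add: inner_complex_def algebra_simps)
  then show ?thesis
    by (simp add: ell2_inner_def infsum_cmult_right')
qed

lemma ell2_norm_diff_scale_power2:
  assumes "u \<in> ell2" "v \<in> ell2"
  shows "(ell2_norm (\<lambda>n. u n - complex_of_real t * v n))\<^sup>2
    = (ell2_norm u)\<^sup>2 - 2 * t * ell2_inner u v + t\<^sup>2 * (ell2_norm v)\<^sup>2"
proof -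
  let ?w = "\<lambda>n. complex_of_real t * v n"
  have w: "?w \<in> ell2"
    by (rule ell2_scale) fact
  have d: "(\<lambda>n. u n - ?w n) \<in> ell2"
    by (intro ell2_diff w assms)
  have "(ell2_norm (\<lambda>n. u n - ?w n))\<^sup>2 = ell2_inner (\<lambda>n. u n - ?w n) (\<lambda>n. u n - ?w n)"
    by (rule ell2_inner_self[symmetric])
  also have "\<dots> = ell2_inner u u - ell2_inner u ?w - (ell2_inner ?w u - ell2_inner ?w ?w)"
    unfolding ell2_inner_diff_left[OF assms(1) w d] ell2_inner_diff_right[OF assms(1) w assms(1)]
      ell2_inner_diff_right[OF assms(1) w w] ..
  also have "\<dots> = ell2_inner u u - 2 * t * ell2_inner u v + t\<^sup>2 * ell2_inner v v"
    unfolding ell2_inner_commute[of ?w u] ell2_inner_scaleR_right ell2_inner_commute[of ?w v]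
    by (simp add: power2_eq_square)
  finally show ?thesis
    by (simp add: ell2_inner_self)
qed

section \<open>Bounded operators and inversion\<close>

lemma bounded_operatorD:
  assumes "bounded_operator T" "u \<in> ell2" "v \<in> ell2"
  shows "T u \<in> ell2"
    and "T (\<lambda>n. u n + v n) = (\<lambda>n. T u n + T v n)"
    and "T (\<lambda>n. c * u n) = (\<lambda>n. c * T u n)"
  using assms by (auto simp: bounded_operator_def)

lemma bounded_operator_diff:
  assumes "bounded_operator T" "u \<in> ell2" "v \<in> ell2"
  shows "T (\<lambda>n. u n - v n) = (\<lambda>n. T u n - T v n)"
proof -
  have "T (\<lambda>n. u n + (-1) * v n) = (\<lambda>n. T u n + (-1) * T v n)"
    unfolding bounded_operatorD(2)[OF assms(1,2) ell2_scale[OF assms(3)]]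
      bounded_operatorD(3)[OF assms(1,3,3)] ..
  then show ?thesis
    by simp
qed

lemma bounded_operator_bound:
  assumes "bounded_operator T"
  obtains K where "K > 0" "\<And>u. u \<in> ell2 \<Longrightarrow> ell2_norm (T u) \<le> K * ell2_norm u"
proof -
  obtain C where C: "\<And>u. u \<in> ell2 \<Longrightarrow> ell2_norm (T u) \<le> C * ell2_norm u"
    using assms unfolding bounded_operator_def by blast
  have "ell2_norm (T u) \<le> max C 1 * ell2_norm u" if "u \<in> ell2" for u
    using C[OF that] mult_right_mono[of C "max C 1" "ell2_norm u"] by simp
  then show thesis
    using that[of "max C 1"] by simp
qed

lemma bounded_operator_diff_scale:
  assumes T: "bounded_operator T"
  shows "bounded_operator (\<lambda>u n. T u n - z * u n)"
proof -
  obtain K where K: "K > 0" "\<And>u. u \<in> ell2 \<Longrightarrow> ell2_norm (T u) \<le> K * ell2_norm u"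
    using bounded_operator_bound[OF T] by blast
  have bound: "ell2_norm (\<lambda>n. T u n - z * u n) \<le> (K + cmod z) * ell2_norm u" if "u \<in> ell2" for u
    using ell2_norm_diff_le[OF bounded_operatorD(1)[OF T that that] ell2_scale[OF that, of z]]
      K(2)[OF that] ell2_norm_scale_le[OF that, of z] by (simp add: algebra_simps)
  show ?thesis
    unfolding bounded_operator_def
  proof (intro conjI ballI allI)
    show "\<exists>C. \<forall>u\<in>ell2. ell2_norm (\<lambda>n. T u n - z * u n) \<le> C * ell2_norm u"
      using bound by blast
  qed (use bounded_operatorD[OF T] in \<open>simp_all add: algebra_simps ell2_diff ell2_scale\<close>)
qed

text \<open>
  Since \<open>T\<close> is normal and bounded below, \<open>T u = g\<close> is equivalent to \<open>T\<^sup>* T u = T\<^sup>* g\<close>, and for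
  small \<open>t\<close> the Richardson map \<open>u \<mapsto> u - t (T\<^sup>* T u - T\<^sup>* g)\<close> is a contraction.
\<close>

lemma normal_bounded_below_surj:
  assumes T: "bounded_operator T" and T': "bounded_operator T'"
    and adj: "\<And>u v. u \<in> ell2 \<Longrightarrow> v \<in> ell2 \<Longrightarrow> ell2_inner (T u) v = ell2_inner u (T' v)"
    and normal: "\<And>u. u \<in> ell2 \<Longrightarrow> T (T' u) = T' (T u)"
    and c: "c > 0" "\<And>u. u \<in> ell2 \<Longrightarrow> c * ell2_norm u \<le> ell2_norm (T u)"
    and g: "g \<in> ell2"
  obtains u where "u \<in> ell2" "T u = g"
proof -
  note TD = bounded_operatorD(1)[OF T _ ell2_zero]
  note T'D = bounded_operatorD(1)[OF T' _ ell2_zero]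
  \<comment> \<open>Normality enters here: it transfers both the upper bound \<open>K\<close> and
    the lower bound \<open>c\<close> from \<open>T\<close> to its adjoint.\<close>
  have norm_eq: "ell2_norm (T' u) = ell2_norm (T u)" if u: "u \<in> ell2" for u
  proof -
    have "(ell2_norm (T' u))\<^sup>2 = ell2_inner (T (T' u)) u"
      using adj[OF T'D[OF u] u] by (simp add: ell2_inner_self)
    also have "\<dots> = ell2_inner (T' (T u)) u"
      by (simp add: normal[OF u])
    also have "\<dots> = (ell2_norm (T u))\<^sup>2"
      using adj[OF u TD[OF u]] by (simp add: ell2_inner_self ell2_inner_commute)
    finally show ?thesis
      by simp
  qed
  obtain K where K: "K > 0" "\<And>u. u \<in> ell2 \<Longrightarrow> ell2_norm (T u) \<le> K * ell2_norm u"
    using bounded_operator_bound[OF T] by blast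
  \<comment> \<open>In the expansion of the squared norm of \<open>B u\<close>,
    \<open>t * K\<^sup>2 \<le> 1\<close> lets the quadratic term be absorbed by half of the linear
    term \<open>2 * t * (ell2_norm (T u))\<^sup>2\<close>. The other half gives the factor
    \<open>1 - t * c\<^sup>2\<close>, nonnegative since
    \<open>t * c\<^sup>2 \<le> 1\<close>.\<close>
  define t where "t = 1 / (K\<^sup>2 + c\<^sup>2)"
  have "0 < K\<^sup>2 + c\<^sup>2"
    using K(1) by (simp add: add_pos_nonneg)
  then have t: "t > 0" "t * K\<^sup>2 \<le> 1" "t * c\<^sup>2 \<le> 1"
    by (simp_all add: t_def)
  define B where "B u = (\<lambda>n. u n - complex_of_real t * T' (T u) n)" for u
  define q where "q = sqrt (1 - t * c\<^sup>2)"
  have q: "0 \<le> q" "q < 1"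
    using t c(1) by (auto simp: q_def)
  have B: "B u \<in> ell2" if "u \<in> ell2" for u
    unfolding B_def by (intro ell2_diff ell2_scale TD T'D that)
  have B_diff: "B (\<lambda>n. u n - v n) = (\<lambda>n. B u n - B v n)" if "u \<in> ell2" "v \<in> ell2" for u v
    unfolding B_def bounded_operator_diff[OF T that] bounded_operator_diff[OF T' TD[OF that(1)] TD[OF that(2)]]
    by (simp add: algebra_simps)
  have contr: "ell2_norm (B u) \<le> q * ell2_norm u" if u: "u \<in> ell2" for u
  proof (rule power2_le_imp_le)
    let ?a = "(ell2_norm (T u))\<^sup>2"
    have "(ell2_norm (T' (T u)))\<^sup>2 \<le> K\<^sup>2 * ?a"
      using K(2)[OF TD[OF u]] norm_eq[OF TD[OF u]] power_mono[of "ell2_norm (T' (T u))" "K * ell2_norm (T u)" 2]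
      by (simp add: power_mult_distrib)
    then have "t\<^sup>2 * (ell2_norm (T' (T u)))\<^sup>2 \<le> t\<^sup>2 * (K\<^sup>2 * ?a)"
      by (intro mult_left_mono) auto
    also have "\<dots> = (t * K\<^sup>2) * (t * ?a)"
      by (simp add: power2_eq_square)
    also have "\<dots> \<le> 1 * (t * ?a)"
      using t by (intro mult_right_mono) auto
    finally have 1: "t\<^sup>2 * (ell2_norm (T' (T u)))\<^sup>2 \<le> t * ?a"
      by simp
    have "c\<^sup>2 * (ell2_norm u)\<^sup>2 \<le> ?a"
      using power_mono[OF c(2)[OF u], of 2] c(1) by (simp add: power_mult_distrib)
    then have 2: "t * (c\<^sup>2 * (ell2_norm u)\<^sup>2) \<le> t * ?a"
      using t by (intro mult_left_mono) auto
    have "ell2_inner u (T' (T u)) = ?a"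
      using adj[OF u TD[OF u]] by (simp add: ell2_inner_self)
    then have "(ell2_norm (B u))\<^sup>2 \<le> (ell2_norm u)\<^sup>2 - t * (c\<^sup>2 * (ell2_norm u)\<^sup>2)"
      unfolding B_def ell2_norm_diff_scale_power2[OF u T'D[OF TD[OF u]]] using 1 2 by simp
    also have "\<dots> = (q * ell2_norm u)\<^sup>2"
      using t by (simp add: q_def power_mult_distrib algebra_simps)
    finally show "(ell2_norm (B u))\<^sup>2 \<le> (q * ell2_norm u)\<^sup>2" .
  qed (use q in simp)
  obtain u where u: "u \<in> ell2" and "u = (\<lambda>n. B u n + complex_of_real t * T' g n)"
    using ell2_affine_fixpoint[OF B B_diff q contr, of "\<lambda>n. complex_of_real t * T' g n"]
      ell2_scale[OF T'D[OF g]] by blast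
  then have "\<And>n. complex_of_real t * (T' (T u) n - T' g n) = 0"
    by (auto simp: B_def fun_eq_iff algebra_simps)
  \<comment> \<open>The fixed point equation says that the adjoint kills \<open>T u - g\<close>; by
    \<open>norm_eq\<close> so does \<open>T\<close>, and the lower bound makes
    \<open>T u - g\<close> vanish.\<close>
  then have "T' (\<lambda>n. T u n - g n) = (\<lambda>n. 0)"
    using t bounded_operator_diff[OF T' TD[OF u] g] by (simp add: fun_eq_iff)
  then have "ell2_norm (T (\<lambda>n. T u n - g n)) = 0"
    using norm_eq[OF ell2_diff[OF TD[OF u] g]] by simp
  then have "ell2_norm (\<lambda>n. T u n - g n) = 0"
    using c(2)[OF ell2_diff[OF TD[OF u] g]] c(1)
    by (metis ell2_norm_nonneg mult_le_0_iff not_less order_antisym)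
  then have "T u = g"
    using ell2_norm_eq_0[OF ell2_diff[OF TD[OF u] g]] by (simp add: fun_eq_iff)
  then show thesis
    using that u by blast
qed

text \<open>\<open>H - z\<close> and its adjoint \<open>H - cnj z\<close> are both polynomials in
  \<open>H\<close>, so they commute and \<open>H - z\<close> is normal for every complex
  \<open>z\<close>; real and nonreal \<open>z\<close> are treated alike.\<close>

lemma symmetric_bounded_below_not_in_spectrum:
  assumes H: "bounded_operator H"
    and symm: "\<And>u v. u \<in> ell2 \<Longrightarrow> v \<in> ell2 \<Longrightarrow> ell2_inner (H u) v = ell2_inner u (H v)"
    and c: "c > 0" "\<And>u. u \<in> ell2 \<Longrightarrow> c * ell2_norm u \<le> ell2_norm (\<lambda>n. H u n - z * u n)"
  shows "z \<notin> spectrum H"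
proof -
  define T where "T u = (\<lambda>n. H u n - z * u n)" for u
  define T' where "T' u = (\<lambda>n. H u n - cnj z * u n)" for u
  have T: "bounded_operator T" and T': "bounded_operator T'"
    unfolding T_def[abs_def] T'_def[abs_def] by (rule bounded_operator_diff_scale[OF H])+
  note HD = bounded_operatorD(1)[OF H _ ell2_zero]
  note TD = bounded_operatorD(1)[OF T _ ell2_zero]
  have adj: "ell2_inner (T u) v = ell2_inner u (T' v)" if "u \<in> ell2" "v \<in> ell2" for u v
    unfolding T_def T'_def
    using that by (simp add: ell2_inner_diff_left ell2_inner_diff_right ell2_scale HD symm
      ell2_inner_scale_adjoint)
  have normal: "T (T' u) = T' (T u)" if u: "u \<in> ell2" for u
    unfolding T_def T'_def bounded_operator_diff[OF H HD[OF u] ell2_scale[OF u]]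
      bounded_operatorD(3)[OF H u u]
    by (simp add: algebra_simps)
  have below: "c * ell2_norm u \<le> ell2_norm (T u)" if "u \<in> ell2" for u
    using c(2)[OF that] by (simp add: T_def)
  have inj: "u = v" if "u \<in> ell2" "v \<in> ell2" "T u = T v" for u v
  proof -
    have "c * ell2_norm (\<lambda>n. u n - v n) \<le> 0"
      using below[OF ell2_diff[OF that(1,2)]] bounded_operator_diff[OF T that(1,2)] that(3) by simp
    then have "ell2_norm (\<lambda>n. u n - v n) = 0"
      using c(1) by (metis ell2_norm_nonneg mult_le_0_iff not_less order_antisym)
    then show ?thesis
      using ell2_norm_eq_0[OF ell2_diff[OF that(1,2)]] by (simp add: fun_eq_iff)
  qed
  have "\<exists>u\<in>ell2. T u = g" if "g \<in> ell2" for g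
    using normal_bounded_below_surj[OF T T' adj normal c(1) below that] by blast
  \<comment> \<open>\<open>S\<close> is a pointwise choice of preimages. Injectivity of
    \<open>T\<close> forces it to be linear and a left inverse as well, and the lower bound gives
    the norm \<open>1 / c\<close>.\<close>
  then obtain S where S: "\<And>g. g \<in> ell2 \<Longrightarrow> S g \<in> ell2" "\<And>g. g \<in> ell2 \<Longrightarrow> T (S g) = g"
    by metis
  have "ell2_norm (S g) \<le> (1 / c) * ell2_norm g" if "g \<in> ell2" for g
    using below[OF S(1)[OF that]] S(2)[OF that] c(1) by (simp add: field_simps)
  moreover have "S (\<lambda>n. u n + v n) = (\<lambda>n. S u n + S v n)" if "u \<in> ell2" "v \<in> ell2" for u v
    by (rule inj) (use that in \<open>simp_all add: S ell2_add bounded_operatorD(2)[OF T]\<close>)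
  moreover have "S (\<lambda>n. a * u n) = (\<lambda>n. a * S u n)" if "u \<in> ell2" for a u
    by (rule inj) (use that in \<open>simp_all add: S ell2_scale bounded_operatorD(3)[OF T _ ell2_zero]\<close>)
  ultimately have "bounded_operator S"
    unfolding bounded_operator_def using S(1) by blast
  moreover have "S (T u) = u" if "u \<in> ell2" for u
    by (rule inj) (use that in \<open>simp_all add: S TD\<close>)
  ultimately show ?thesis
    unfolding spectrum_def using S(2) by (auto simp: T_def)
qed

text \<open>The condition that the image lies in \<open>ell2\<close> takes the place of boundedness
  of \<open>H\<close>. The lemma thus applies to \<open>H_random\<close> for any sample, even one
  whose potential is unbounded.\<close>

lemma not_in_spectrum_bounded_below:
  assumes "z \<notin> spectrum H"
  obtains C where "C > 0"
    "\<And>u. u \<in> ell2 \<Longrightarrow> (\<lambda>n. H u n - z * u n) \<in> ell2 \<Longrightarrow>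
      ell2_norm u \<le> C * ell2_norm (\<lambda>n. H u n - z * u n)"
proof -
  obtain S where S: "bounded_operator S" "\<And>u. u \<in> ell2 \<Longrightarrow> S (\<lambda>n. H u n - z * u n) = u"
    using assms unfolding spectrum_def by blast
  obtain C where "C > 0" "\<And>u. u \<in> ell2 \<Longrightarrow> ell2_norm (S u) \<le> C * ell2_norm u"
    using bounded_operator_bound[OF S(1)] by blast
  then show thesis
    using that S(2) by metis
qed

section \<open>The lattice operators\<close>

text \<open>Each shift is an isometry of \<open>ell2\<close>, so the norm is at most
  \<open>card E + K\<close>. The unit sphere as \<open>E\<close> gives the discrete Schroedinger
  operators.\<close>

lemma hopping_operator_bounded:
  fixes E :: "'a :: ab_group_add set" and w :: "'a \<Rightarrow> real"
  assumes E: "finite E" and w: "\<And>n. \<bar>w n\<bar> \<le> K"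
  shows "bounded_operator (\<lambda>u n. (\<Sum>e\<in>E. u (n + e)) + complex_of_real (w n) * u n)"
proof -
  have K: "0 \<le> K"
    using w[of undefined] by linarith
  have shift: "(\<lambda>n. u (n + e)) \<in> ell2" "ell2_norm (\<lambda>n. u (n + e)) = ell2_norm u"
    if "u \<in> ell2" for u :: "'a \<Rightarrow> complex" and e
    by (rule ell2_reindex[OF bij_plus_right that], rule ell2_norm_reindex[OF bij_plus_right])
  have mult: "(\<lambda>n. complex_of_real (w n) * u n) \<in> ell2"
    "ell2_norm (\<lambda>n. complex_of_real (w n) * u n) \<le> K * ell2_norm u" if "u \<in> ell2" for u
  proof -
    have "cmod (complex_of_real (w n) * u n) \<le> K * cmod (u n)" for n
      using w[of n] by (auto intro!: mult_right_mono simp: norm_mult)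
    then show "(\<lambda>n. complex_of_real (w n) * u n) \<in> ell2"
      "ell2_norm (\<lambda>n. complex_of_real (w n) * u n) \<le> K * ell2_norm u"
      by (rule ell2_dominated[OF that K], rule ell2_norm_dominated[OF that K])
  qed
  have hop: "(\<lambda>n. \<Sum>e\<in>E. u (n + e)) \<in> ell2" if "u \<in> ell2" for u
    by (rule ell2_sum[OF E shift(1)[OF that]])
  have bound: "ell2_norm (\<lambda>n. (\<Sum>e\<in>E. u (n + e)) + complex_of_real (w n) * u n)
      \<le> (real (card E) + K) * ell2_norm u" if u: "u \<in> ell2" for u
  proof -
    have "ell2_norm (\<lambda>n. \<Sum>e\<in>E. u (n + e)) \<le> (\<Sum>e\<in>E. ell2_norm (\<lambda>n. u (n + e)))"
      by (rule ell2_norm_sum_le[OF E shift(1)[OF u]])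
    also have "\<dots> = real (card E) * ell2_norm u"
      by (simp add: shift(2)[OF u])
    finally show ?thesis
      using ell2_norm_triangle[OF hop[OF u] mult(1)[OF u]] mult(2)[OF u] by (simp add: distrib_right)
  qed
  show ?thesis
    unfolding bounded_operator_def
  proof (intro conjI ballI allI)
    show "\<exists>C. \<forall>u\<in>ell2. ell2_norm (\<lambda>n. (\<Sum>e\<in>E. u (n + e)) + complex_of_real (w n) * u n)
        \<le> C * ell2_norm u"
      using bound by blast
    show "(\<lambda>n. (\<Sum>e\<in>E. u (n + e)) + complex_of_real (w n) * u n) \<in> ell2" if "u \<in> ell2" for u
      by (rule ell2_add[OF hop[OF that] mult(1)[OF that]])
  qed (simp_all add: algebra_simps sum.distrib sum_distrib_left)
qed

text \<open>The adjoint of the shift by \<open>e\<close> is the shift by \<open>- e\<close>, so a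
  set \<open>E\<close> closed under negation gives a symmetric sum; the diagonal is symmetric
  because \<open>w\<close> is real.\<close>

lemma hopping_operator_symmetric:
  fixes E :: "'a :: ab_group_add set" and w :: "'a \<Rightarrow> real"
  assumes E: "finite E" "uminus ` E = E" and w: "\<And>n. \<bar>w n\<bar> \<le> K"
    and u: "u \<in> ell2" and v: "v \<in> ell2"
  shows "ell2_inner (\<lambda>n. (\<Sum>e\<in>E. u (n + e)) + complex_of_real (w n) * u n) v
    = ell2_inner u (\<lambda>n. (\<Sum>e\<in>E. v (n + e)) + complex_of_real (w n) * v n)"
proof -
  have shift: "(\<lambda>n. x (n + e)) \<in> ell2" if "x \<in> ell2" for x :: "'a \<Rightarrow> complex" and e
    by (rule ell2_reindex[OF bij_plus_right that])
  have mult: "(\<lambda>n. complex_of_real (w n) * x n) \<in> ell2" if "x \<in> ell2" for x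
  proof (rule ell2_dominated[OF that])
    show "0 \<le> K"
      using w[of undefined] by linarith
    show "cmod (complex_of_real (w n) * x n) \<le> K * cmod (x n)" for n
      using w[of n] by (auto intro!: mult_right_mono simp: norm_mult)
  qed
  have sums: "ell2_inner (\<lambda>n. \<Sum>e\<in>A. f e n) x = (\<Sum>e\<in>A. ell2_inner (f e) x)"
    if "finite A" "\<And>e. f e \<in> ell2" "x \<in> ell2"
    for A and f :: "'a \<Rightarrow> 'a \<Rightarrow> complex" and x :: "'a \<Rightarrow> complex"
    using that(1)
  proof (induction A rule: finite_induct)
    case (insert e A)
    then show ?case
      using ell2_inner_add_left[OF that(2) ell2_sum[OF insert(1) that(2)] that(3)] by simp
  qed (simp add: ell2_inner_def)
  have "ell2_inner (\<lambda>n. u (n + e)) v = ell2_inner (\<lambda>n. v (n + (- e))) u" for e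
    unfolding ell2_inner_def
    using infsum_reindex_bij_betw[OF bij_plus_right[of e], of "\<lambda>n. u n \<bullet> v (n - e)"]
    by (simp add: inner_commute)
  then have "(\<Sum>e\<in>E. ell2_inner (\<lambda>n. u (n + e)) v) = (\<Sum>e\<in>E. ell2_inner (\<lambda>n. v (n + (- e))) u)"
    by simp
  also have "\<dots> = (\<Sum>e\<in>uminus ` E. ell2_inner (\<lambda>n. v (n + e)) u)"
    by (subst sum.reindex) (auto simp: inj_on_def)
  finally have hop: "ell2_inner (\<lambda>n. \<Sum>e\<in>E. u (n + e)) v = ell2_inner u (\<lambda>n. \<Sum>e\<in>E. v (n + e))"
    using sums[OF E(1) shift[OF u] v] sums[OF E(1) shift[OF v] u]
    by (simp add: E(2) ell2_inner_commute[of u "\<lambda>n. \<Sum>e\<in>E. v (n + e)"])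
  have "ell2_inner (\<lambda>n. complex_of_real (w n) * u n) v
      = ell2_inner u (\<lambda>n. complex_of_real (w n) * v n)"
    unfolding ell2_inner_def by (rule infsum_cong) (simp add: inner_complex_def algebra_simps)
  then show ?thesis
    using ell2_inner_add_left[OF ell2_sum[OF E(1) shift[OF u]] mult[OF u] v]
      ell2_inner_add_right[OF ell2_sum[OF E(1) shift[OF v]] mult[OF v] u] hop
    by simp
qed

section \<open>Boxes and cubes in the lattice\<close>

lemma finite_int_box: "finite {n :: int ^ 'd. \<forall>i. \<bar>n $ i\<bar> \<le> k}"
proof (rule finite_subset)
  show "{n :: int ^ 'd. \<forall>i. \<bar>n $ i\<bar> \<le> k} \<subseteq> vec_lambda ` (UNIV \<rightarrow>\<^sub>E {- k..k})"
  proof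
    fix n :: "int ^ 'd" assume "n \<in> {n. \<forall>i. \<bar>n $ i\<bar> \<le> k}"
    then have "- k \<le> n $ i \<and> n $ i \<le> k" for i
      by (simp add: abs_le_iff minus_le_iff)
    then show "n \<in> vec_lambda ` (UNIV \<rightarrow>\<^sub>E {- k..k})"
      by (intro image_eqI[of _ _ "($) n"]) auto
  qed
  show "finite (vec_lambda ` (UNIV \<rightarrow>\<^sub>E {- k..k} :: ('d \<Rightarrow> int) set))"
    by (intro finite_imageI finite_PiE) auto
qed

lemma mem_cube_0_iff: "n \<in> cube 0 s \<longleftrightarrow> (\<forall>i. real_of_int \<bar>n $ i\<bar> \<le> s / 2)"
proof -
  have "real_of_int (max_norm n) \<le> s / 2 \<longleftrightarrow> max_norm n \<le> \<lfloor>s / 2\<rfloor>"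
    by (simp add: le_floor_iff)
  also have "\<dots> \<longleftrightarrow> (\<forall>i. \<bar>n $ i\<bar> \<le> \<lfloor>s / 2\<rfloor>)"
    by (simp add: max_norm_def)
  finally show ?thesis
    by (simp add: cube_def le_floor_iff)
qed

lemma finite_cube_0: "finite (cube 0 s)"
  by (rule finite_subset[OF _ finite_int_box[of "\<lfloor>s / 2\<rfloor>"]]) (auto simp: mem_cube_0_iff le_floor_iff)

lemma finite_subset_cube_0:
  fixes F :: "(int ^ 'd) set"
  assumes "finite F"
  obtains k where "F \<subseteq> cube 0 (real k)"
proof -
  have "eventually (\<lambda>k. c \<le> real k / 2) sequentially" for c :: real
    by real_asymp
  then have "eventually (\<lambda>k. \<forall>n\<in>F. \<forall>i. real_of_int \<bar>n $ i\<bar> \<le> real k / 2) sequentially"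
    using assms by (intro eventually_ball_finite ballI eventually_all_finite)
  then obtain k where "\<forall>n\<in>F. \<forall>i. real_of_int \<bar>n $ i\<bar> \<le> real k / 2"
    unfolding eventually_sequentially by blast
  then have "F \<subseteq> cube 0 (real k)"
    by (simp add: subset_iff mem_cube_0_iff)
  then show thesis
    by (rule that)
qed

lemma cube_0_mono: "s \<le> t \<Longrightarrow> cube 0 s \<subseteq> cube 0 t"
  by (auto simp: cube_def)

text \<open>The diagonal points \<open>(j, ..., j)\<close> with
  \<open>0 \<le> j \<le> L div 2\<close> already suffice. This crude linear growth makes a bounded
  count have frequency tending to zero.\<close>

lemma card_cube_0_ge: "real L / 2 \<le> real (card (cube (0 :: int ^ 'd) (real L)))"
proof -
  have "(\<lambda>j. vec (int j) :: int ^ 'd) ` {..L div 2} \<subseteq> cube 0 (real L)"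
    by (auto simp: mem_cube_0_iff)
  moreover have "inj_on (\<lambda>j. vec (int j) :: int ^ 'd) {..L div 2}"
    by (auto simp: inj_on_def vec_eq_iff)
  ultimately have "card {..L div 2} \<le> card (cube (0 :: int ^ 'd) (real L))"
    by (metis card_image card_mono finite_cube_0)
  then have "L \<le> 2 * card (cube (0 :: int ^ 'd) (real L))"
    by simp
  then show ?thesis
    by linarith
qed

section \<open>The Laplacian and \<open>H0\<close> as hopping operators\<close>

lemma finite_l1_sphere: "finite {e :: int ^ 'd. l1_norm e = k}"
proof (rule finite_subset[OF _ finite_int_box[of k]])
  show "{e :: int ^ 'd. l1_norm e = k} \<subseteq> {n. \<forall>i. \<bar>n $ i\<bar> \<le> k}"
    by (auto simp: l1_norm_def intro!: member_le_sum)
qed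

lemma uminus_l1_sphere: "uminus ` {e :: int ^ 'd. l1_norm e = k} = {e. l1_norm e = k}"
proof -
  have "l1_norm (- e) = l1_norm e" for e :: "int ^ 'd"
    by (simp add: l1_norm_def)
  then show ?thesis
    by (auto intro!: image_eqI[of _ uminus "- _"])
qed

text \<open>Substituting \<open>m = n + e\<close> makes the index set independent of
  \<open>n\<close>, which exposes translation invariance. The number of neighbours stays symbolic
  and joins the diagonal.\<close>

lemma laplacian_alt:
  "laplacian u n = (\<Sum>e | l1_norm e = 1. u (n + e)) - of_nat (card {e :: int ^ 'd. l1_norm e = 1}) * u n"
  for n :: "int ^ 'd"
proof -
  have "laplacian u n = (\<Sum>e | l1_norm e = 1. u (n + e) - u n)"
    unfolding laplacian_def
    by (rule sum.reindex_bij_witness[of _ "\<lambda>e. n + e" "\<lambda>m. m - n"]) auto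
  then show ?thesis
    by (simp add: sum_subtractf)
qed

lemma H0_hopping:
  fixes D :: "(int ^ 'd) set" and M :: real
  defines "w \<equiv> \<lambda>n. V0 M D n + 4 * real CARD('d) - real (card {e :: int ^ 'd. l1_norm e = 1})"
  shows "H0 M D = (\<lambda>u n. (\<Sum>e | l1_norm e = 1. u (n + e)) + complex_of_real (w n) * u n)"
  by (intro ext) (simp add: H0_def laplacian_alt w_def algebra_simps)

lemma H0_diagonal_bounded:
  "\<bar>V0 M D n + a - b\<bar> \<le> \<bar>M\<bar> + \<bar>a\<bar> + \<bar>b\<bar>"
  by (auto simp: V0_def indicator_def)

lemma bounded_operator_H0: "bounded_operator (H0 M D)"
  unfolding H0_hopping by (rule hopping_operator_bounded[OF finite_l1_sphere H0_diagonal_bounded])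

lemma H0_symmetric:
  "u \<in> ell2 \<Longrightarrow> v \<in> ell2 \<Longrightarrow> ell2_inner (H0 M D u) v = ell2_inner u (H0 M D v)"
  unfolding H0_hopping
  by (rule hopping_operator_symmetric[OF finite_l1_sphere uminus_l1_sphere H0_diagonal_bounded])

text \<open>The hopping part commutes with translations, so only \<open>V0\<close> can differ. At
  sites \<open>n + y\<close> inside \<open>W\<close> the two configurations agree, and outside
  \<open>W\<close> the factor \<open>u (n + y)\<close> is zero.\<close>

lemma H0_translate:
  fixes D :: "(int ^ 'd) set"
  assumes "\<And>n. n \<notin> W \<Longrightarrow> u n = 0" and "\<And>n. n \<in> W \<Longrightarrow> n \<in> D \<longleftrightarrow> n - y \<in> D"
  shows "H0 M D (\<lambda>n. u (n + y)) n = H0 M D u (n + y)"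
proof -
  have "complex_of_real (V0 M D n) * u (n + y) = complex_of_real (V0 M D (n + y)) * u (n + y)"
    using assms(1)[of "n + y"] assms(2)[of "n + y"]
    by (cases "n + y \<in> W") (auto simp: V0_def indicator_def)
  then show ?thesis
    by (simp add: H0_def laplacian_alt algebra_simps)
qed

text \<open>The deterministic core, for one fixed sample \<open>w\<close>. A single index
  \<open>k\<close> governs both window size and tolerance, so the hypothesis is a countable family
  of conditions.\<close>

lemma spectrum_H0_subset:
  fixes D :: "(int ^ 'd) set"
  assumes copies: "\<And>k. \<exists>y. (\<forall>n\<in>cube 0 (real k). n \<in> D \<longleftrightarrow> n - y \<in> D) \<and>
      (\<forall>n\<in>cube 0 (real k) \<inter> D. \<bar>w (n - y)\<bar> \<le> 1 / (real k + 1))"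
  shows "spectrum (H0 M D) \<subseteq> spectrum (H_random M D w)"
proof -
  have "z \<notin> spectrum (H0 M D)" if z: "z \<notin> spectrum (H_random M D w)" for z
  proof -
    let ?T = "\<lambda>u n. H0 M D u n - z * u n"
    obtain C where C: "C > 0" "\<And>u. u \<in> ell2 \<Longrightarrow> (\<lambda>n. H_random M D w u n - z * u n) \<in> ell2 \<Longrightarrow>
        ell2_norm u \<le> C * ell2_norm (\<lambda>n. H_random M D w u n - z * u n)"
      using not_in_spectrum_bounded_below[OF z] by blast
    have T: "bounded_operator ?T"
      by (rule bounded_operator_diff_scale[OF bounded_operator_H0])
    note TD = bounded_operatorD(1)[OF T _ ell2_zero]
    have fin: "ell2_norm u \<le> C * ell2_norm (?T u)"
      if F: "finite F" "\<And>n. n \<notin> F \<Longrightarrow> u n = 0" for F and u :: "int ^ 'd \<Rightarrow> complex"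
    proof -
      have u: "u \<in> ell2"
        using F by (rule ell2_finite_support)
      obtain k0 where k0: "F \<subseteq> cube 0 (real k0)"
        using finite_subset_cube_0[OF F(1)] by blast
      have le: "ell2_norm u \<le> C * (ell2_norm (?T u) + 1 / (real k + 1) * ell2_norm u)" if "k \<ge> k0" for k
      proof -
        let ?W = "cube 0 (real k) :: (int ^ 'd) set"
        obtain y where y: "\<And>n. n \<in> ?W \<Longrightarrow> n \<in> D \<longleftrightarrow> n - y \<in> D"
          "\<And>n. n \<in> ?W \<Longrightarrow> n \<in> D \<Longrightarrow> \<bar>w (n - y)\<bar> \<le> 1 / (real k + 1)"
          using copies[of k] by blast
        have FW: "F \<subseteq> ?W"
          using k0 cube_0_mono[of "real k0" "real k"] that by auto
        \<comment> \<open>\<open>v\<close> is \<open>u\<close> moved into the near copy of the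
          window; \<open>p\<close> below is all that the random potential contributes there, and is
          treated as an error.\<close>
        define v where "v = (\<lambda>n. u (n + y))"
        define p where "p = (\<lambda>n. complex_of_real (V_random D w n) * v n)"
        have bij: "bij (\<lambda>n. n + y)"
          by (rule bij_plus_right)
        have v: "v \<in> ell2" "ell2_norm v = ell2_norm u"
          unfolding v_def by (rule ell2_reindex[OF bij u], rule ell2_norm_reindex[OF bij])
        have "cmod (p n) \<le> 1 / (real k + 1) * cmod (v n)" for n
        \<comment> \<open>The properties of the copy are used at \<open>n + y\<close>: agreement of
          configurations turns \<open>n \<in> D\<close> into \<open>n + y \<in> D\<close>, and then
          the tolerance bounds \<open>w n\<close>.\<close>
        proof (cases "n + y \<in> F \<and> n \<in> D")
          case True
          then have "\<bar>w n\<bar> \<le> 1 / (real k + 1)"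
            using y(1,2)[of "n + y"] FW by auto
          then show ?thesis
            unfolding p_def norm_mult using True by (intro mult_right_mono) (auto simp: V_random_def)
        next
          case False
          then have "p n = 0"
            using F(2)[of "n + y"] by (auto simp: p_def v_def V_random_def)
          then show ?thesis
            by simp
        qed
        then have p: "p \<in> ell2" "ell2_norm p \<le> 1 / (real k + 1) * ell2_norm u"
          using ell2_dominated[OF v(1), of "1 / (real k + 1)" p]
            ell2_norm_dominated[OF v(1), of "1 / (real k + 1)" p] v(2) by auto
        have H0v: "H0 M D v n = H0 M D u (n + y)" for n
          unfolding v_def by (rule H0_translate[of ?W]) (use F(2) FW y(1) in auto)
        have eq: "(\<lambda>n. H_random M D w v n - z * v n) = (\<lambda>n. ?T u (n + y) + p n)"
          unfolding H_random_def H0v by (simp add: p_def v_def algebra_simps)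
        have Tu: "(\<lambda>n. ?T u (n + y)) \<in> ell2" "ell2_norm (\<lambda>n. ?T u (n + y)) = ell2_norm (?T u)"
          by (rule ell2_reindex[OF bij TD[OF u]], rule ell2_norm_reindex[OF bij])
        have "ell2_norm u \<le> C * ell2_norm (\<lambda>n. ?T u (n + y) + p n)"
          using C(2)[OF v(1)] ell2_add[OF Tu(1) p(1)] unfolding eq v(2) by blast
        also have "\<dots> \<le> C * (ell2_norm (?T u) + 1 / (real k + 1) * ell2_norm u)"
          using ell2_norm_triangle[OF Tu(1) p(1)] p(2) Tu(2) C(1) by (intro mult_left_mono) auto
        finally show ?thesis .
      qed
      \<comment> \<open>The constant \<open>C\<close> does not depend on \<open>k\<close>, so
        letting \<open>k\<close> grow removes the error without spoiling the bound.\<close>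
      have "(\<lambda>k. C * (ell2_norm (?T u) + 1 / (real k + 1) * ell2_norm u))
          \<longlonglongrightarrow> C * (ell2_norm (?T u) + 0 * ell2_norm u)"
        by (intro tendsto_intros) real_asymp
      then have "ell2_norm u \<le> C * (ell2_norm (?T u) + 0 * ell2_norm u)"
        by (rule LIMSEQ_le_const) (use le in blast)
      then show ?thesis
        by simp
    qed
    obtain K where K: "K > 0" "\<And>u. u \<in> ell2 \<Longrightarrow> ell2_norm (?T u) \<le> K * ell2_norm u"
      using bounded_operator_bound[OF T] by blast
    have all: "ell2_norm u \<le> C * ell2_norm (?T u)" if u: "u \<in> ell2" for u
    proof (rule field_le_epsilon)
      fix e :: real assume "e > 0"
      \<comment> \<open>Truncating \<open>u\<close> costs \<open>\<delta>\<close> on the left side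
        and \<open>C * K * \<delta>\<close> on the right; together these make
        \<open>e\<close>.\<close>
      define \<delta> where "\<delta> = e / (C * K + 1)"
      have CK: "C * K + 1 > 0"
        using C(1) K(1) by (simp add: add_pos_pos)
      then have "\<delta> > 0"
        using \<open>e > 0\<close> by (simp add: \<delta>_def)
      then obtain F where F: "finite F" "ell2_norm (\<lambda>n. u n - (if n \<in> F then u n else 0)) \<le> \<delta>"
        using ell2_finite_approx[OF u] by blast
      define v where "v = (\<lambda>n. if n \<in> F then u n else 0)"
      have v: "v \<in> ell2"
        using F(1) by (rule ell2_finite_support) (simp add: v_def)
      have d: "ell2_norm (\<lambda>n. u n - v n) \<le> \<delta>"
        using F(2) by (simp add: v_def)
      have "ell2_norm (?T (\<lambda>n. u n - v n)) \<le> K * \<delta>"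
        using K(2)[OF ell2_diff[OF u v]] mult_left_mono[OF d, of K] K(1) by linarith
      then have "ell2_norm (\<lambda>n. ?T v n - ?T u n) \<le> K * \<delta>"
        unfolding bounded_operator_diff[OF T u v] by (subst ell2_norm_diff_commute)
      then have "ell2_norm (?T v) \<le> ell2_norm (?T u) + K * \<delta>"
        using ell2_norm_le_diff[OF TD[OF v] TD[OF u]] by linarith
      then have "C * ell2_norm (?T v) \<le> C * (ell2_norm (?T u) + K * \<delta>)"
        using C(1) by (intro mult_left_mono) auto
      moreover have "ell2_norm v \<le> C * ell2_norm (?T v)"
        using F(1) by (rule fin) (simp add: v_def)
      moreover have "ell2_norm u \<le> ell2_norm v + \<delta>"
        using ell2_norm_le_diff[OF u v] d by linarith
      moreover have "(C * K + 1) * \<delta> = e"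
        using CK by (simp add: \<delta>_def)
      ultimately show "ell2_norm u \<le> C * ell2_norm (?T u) + e"
        by (simp add: algebra_simps)
    qed
    show ?thesis
    proof (rule symmetric_bounded_below_not_in_spectrum[OF bounded_operator_H0 H0_symmetric])
      show "0 < 1 / C"
        using C(1) by simp
      show "1 / C * ell2_norm u \<le> ell2_norm (?T u)" if "u \<in> ell2" for u
        using all[OF that] C(1) by (simp add: field_simps)
    qed
  qed
  then show ?thesis
    by blast
qed

section \<open>Independent translates\<close>

text \<open>All variables of a block hit \<open>U\<close> with probability \<open>p ^ m\<close>.
  Disjoint blocks are independent, so their failures multiply.\<close>

lemma (in prob_space) prob_all_copies_fail:
  fixes X :: "'i \<Rightarrow> 'a \<Rightarrow> 'b"
  assumes indep: "indep_vars (\<lambda>_. N) X D"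
    and U: "U \<in> sets N" and p: "\<And>n. n \<in> D \<Longrightarrow> prob (X n -` U \<inter> space M) = p"
    and K: "\<And>z. z \<in> Z \<Longrightarrow> K z \<subseteq> D \<and> finite (K z) \<and> K z \<noteq> {} \<and> card (K z) = m"
    and Z: "finite Z" "disjoint_family_on K Z"
  shows "{a \<in> space M. \<forall>z\<in>Z. \<exists>n\<in>K z. X n a \<notin> U} \<in> events"
    and "prob {a \<in> space M. \<forall>z\<in>Z. \<exists>n\<in>K z. X n a \<notin> U} = (1 - p ^ m) ^ card Z"
proof -
  have X: "X n \<in> measurable M N" if "n \<in> D" for n
    using indep that by (auto simp: indep_vars_def)
  have XU: "X n -` U \<inter> space M \<in> events" if "n \<in> D" for n
    using measurable_sets[OF X[OF that] U] .
  have cyl: "(\<Inter>n\<in>K z. X n -` U \<inter> space M) \<in> events" if "z \<in> Z" for z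
    using K[OF that] XU by (intro sets.finite_INT) auto
  have prob_cyl: "prob (\<Inter>n\<in>K z. X n -` U \<inter> space M) = p ^ m" if "z \<in> Z" for z
  proof -
    have "prob (\<Inter>n\<in>K z. X n -` U \<inter> space M) = (\<Prod>n\<in>K z. prob (X n -` U \<inter> space M))"
      using K[OF that] U by (intro indep_varsD[OF indep]) auto
    also have "\<dots> = (\<Prod>n\<in>K z. p)"
      using K[OF that] p by (intro prod.cong) auto
    finally show ?thesis
      using K[OF that] by simp
  qed
  \<comment> \<open>\<open>Y z\<close> bundles the variables of a block into one random element of a
    product space, and \<open>B z\<close> is the set where some coordinate misses
    \<open>U\<close>.\<close>
  define Y where "Y z a = restrict (\<lambda>n. X n a) (K z)" for z a
  define B where "B z = space (PiM (K z) (\<lambda>_. N)) - PiE (K z) (\<lambda>_. U)" for z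
  have Y: "indep_vars (\<lambda>z. PiM (K z) (\<lambda>_. N)) Y Z"
    unfolding Y_def[abs_def] using K Z by (intro indep_vars_restrict[OF indep]) auto
  have B: "B z \<in> sets (PiM (K z) (\<lambda>_. N))" if "z \<in> Z" for z
    unfolding B_def using K[OF that] U by (intro sets.Diff sets.top sets_PiM_I_finite) auto
  have YB: "Y z -` B z \<inter> space M = {a \<in> space M. \<exists>n\<in>K z. X n a \<notin> U}" if "z \<in> Z" for z
    using K[OF that] measurable_space[OF X]
    by (auto simp: Y_def B_def space_PiM PiE_iff subset_eq)
  have compl: "{a \<in> space M. \<exists>n\<in>K z. X n a \<notin> U} = space M - (\<Inter>n\<in>K z. X n -` U \<inter> space M)"
    if "z \<in> Z" for z
    using K[OF that] by auto
  have ev: "{a \<in> space M. \<exists>n\<in>K z. X n a \<notin> U} \<in> events" if "z \<in> Z" for z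
    unfolding compl[OF that] using cyl[OF that] by auto
  have pr: "prob (Y z -` B z \<inter> space M) = 1 - p ^ m" if "z \<in> Z" for z
    unfolding YB[OF that] compl[OF that] using prob_compl[OF cyl[OF that]] prob_cyl[OF that] by simp
  show "{a \<in> space M. \<forall>z\<in>Z. \<exists>n\<in>K z. X n a \<notin> U} \<in> events"
    using ev Z(1) by (intro sets.sets_Collect_finite_All) auto
  show "prob {a \<in> space M. \<forall>z\<in>Z. \<exists>n\<in>K z. X n a \<notin> U} = (1 - p ^ m) ^ card Z"
  \<comment> \<open>An intersection over an empty \<open>Z\<close> would not be an event of the
    space; there the set in question is the whole space and both sides are 1.\<close>
  proof (cases "Z = {}")
    case False
    have "{a \<in> space M. \<forall>z\<in>Z. \<exists>n\<in>K z. X n a \<notin> U} = (\<Inter>z\<in>Z. Y z -` B z \<inter> space M)"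
      using False YB by auto
    moreover have "prob (\<Inter>z\<in>Z. Y z -` B z \<inter> space M) = (\<Prod>z\<in>Z. prob (Y z -` B z \<inter> space M))"
      using False Z B by (intro indep_varsD[OF Y]) auto
    ultimately show ?thesis
      using pr by simp
  qed (simp add: prob_space)
qed

text \<open>Greedy choice: \<open>W - y\<close> and \<open>W - z\<close> meet only if
  \<open>y = n - m + z\<close> for some \<open>n\<close>, \<open>m\<close> in \<open>W\<close>, so
  the finitely many earlier choices exclude only finitely many \<open>y\<close>.\<close>

lemma disjoint_translates:
  fixes Y W :: "'a :: ab_group_add set"
  assumes "infinite Y" "finite W" "W \<noteq> {}"
  shows "\<exists>Z\<subseteq>Y. finite Z \<and> card Z = N \<and> disjoint_family_on (\<lambda>y. (\<lambda>n. n - y) ` W) Z"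
proof (induction N)
  case 0
  show ?case
    by (intro exI[of _ "{}"]) (auto simp: disjoint_family_on_def)
next
  case (Suc N)
  then obtain Z where Z: "Z \<subseteq> Y" "finite Z" "card Z = N"
    "disjoint_family_on (\<lambda>y. (\<lambda>n. n - y) ` W) Z"
    by blast
  define A where "A = (\<lambda>(n, m, z). n - m + z) ` (W \<times> W \<times> Z)"
  have "finite A"
    using assms Z by (simp add: A_def)
  then obtain y where y: "y \<in> Y" "y \<notin> A"
    using assms(1) by (meson finite_subset subsetI)
  \<comment> \<open>The case \<open>n = m\<close> puts every element of \<open>Z\<close> into
    \<open>A\<close>, so avoiding \<open>A\<close> also makes \<open>y\<close> new and the
    cardinality grows.\<close>
  have "y \<notin> Z"
  proof
    assume "y \<in> Z"
    moreover obtain n where "n \<in> W"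
      using assms(3) by blast
    ultimately have "(\<lambda>(n, m, z). n - m + z) (n, n, y) \<in> A"
      unfolding A_def by (intro imageI) simp
    then show False
      using y(2) by simp
  qed
  have "(\<lambda>n. n - y) ` W \<inter> (\<lambda>n. n - z) ` W = {}" if "z \<in> Z" for z
  proof (rule ccontr)
    assume "(\<lambda>n. n - y) ` W \<inter> (\<lambda>n. n - z) ` W \<noteq> {}"
    then obtain n m where nm: "n \<in> W" "m \<in> W" "n - y = m - z"
      by auto
    then have "(\<lambda>(n, m, z). n - m + z) (n, m, z) \<in> A"
      unfolding A_def using that by (intro imageI) simp
    moreover have "n - m + z = y"
      using nm(3) by (simp add: algebra_simps)
    ultimately show False
      using y(2) by simp
  qed
  then have "disjoint_family_on (\<lambda>y. (\<lambda>n. n - y) ` W) (insert y Z)"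
    using Z(4) by (auto simp: disjoint_family_on_def)
  then show ?case
    using Z y(1) \<open>y \<notin> Z\<close> by (intro exI[of _ "insert y Z"]) auto
qed

text \<open>
  The bad event is contained in the failure of arbitrarily many disjoint, hence independent,
  translates of \<open>W\<close>.
\<close>

lemma (in prob_space) AE_translate_hits:
  fixes X :: "'i :: ab_group_add \<Rightarrow> 'a \<Rightarrow> 'b"
  assumes indep: "indep_vars (\<lambda>_. N) X D"
    and U: "U \<in> sets N" and p: "\<And>n. n \<in> D \<Longrightarrow> prob (X n -` U \<inter> space M) = p" "p > 0"
    and W: "finite W" "W \<noteq> {}" and Y: "infinite Y"
    and sub: "\<And>y n. y \<in> Y \<Longrightarrow> n \<in> W \<Longrightarrow> n - y \<in> D"
  shows "AE a in M. \<exists>y\<in>Y. \<forall>n\<in>W. X (n - y) a \<in> U"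
proof -
  define K where "K y = (\<lambda>n. n - y) ` W" for y
  define m where "m = card W"
  obtain Z where Z: "\<And>i. Z i \<subseteq> Y" "\<And>i. finite (Z i)" "\<And>i. card (Z i) = i"
    "\<And>i. disjoint_family_on K (Z i)"
    using disjoint_translates[OF Y W] unfolding K_def[abs_def] by metis
  define B where "B i = {a \<in> space M. \<forall>z\<in>Z i. \<exists>n\<in>K z. X n a \<notin> U}" for i
  have K: "K z \<subseteq> D \<and> finite (K z) \<and> K z \<noteq> {} \<and> card (K z) = m" if "z \<in> Z i" for z i
    using W sub that Z(1)[of i] by (auto simp: K_def m_def card_image inj_on_def)
  have B: "B i \<in> events" "prob (B i) = (1 - p ^ m) ^ i" for i
    using prob_all_copies_fail[OF indep U p(1) K Z(2,4), of i] by (auto simp: B_def Z(3))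
  \<comment> \<open>\<open>p\<close> is known to be a probability only at points of
    \<open>D\<close>; one is produced from elements of \<open>Y\<close> and
    \<open>W\<close>.\<close>
  have "p \<le> 1"
  proof -
    obtain y n where "y \<in> Y" "n \<in> W"
      using W Y by (metis all_not_in_conv finite.emptyI)
    then show ?thesis
      using p(1)[OF sub] prob_le_1 by metis
  qed
  then have q: "0 \<le> 1 - p ^ m" "1 - p ^ m < 1"
    using p(2) by (auto simp: power_le_one)
  have IntB: "(\<Inter>i. B i) \<in> events"
    using B(1) by auto
  have "prob (\<Inter>i. B i) \<le> (1 - p ^ m) ^ i" for i
    using finite_measure_mono[OF _ B(1), of "\<Inter>i. B i" i] B(2)[of i] by auto
  moreover have "(\<lambda>i. (1 - p ^ m) ^ i) \<longlonglongrightarrow> 0"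
    using q by (intro LIMSEQ_power_zero) auto
  ultimately have "prob (\<Inter>i. B i) \<le> 0"
    by (intro LIMSEQ_le_const) auto
  then have "emeasure M (\<Inter>i. B i) = 0"
    by (simp add: emeasure_eq_measure measure_le_0_iff)
  \<comment> \<open>The exceptional set need not be shown measurable: it is enclosed in a null
    event.\<close>
  moreover have "{a \<in> space M. \<not> (\<exists>y\<in>Y. \<forall>n\<in>W. X (n - y) a \<in> U)} \<subseteq> (\<Inter>i. B i)"
    using Z(1) by (fastforce simp: B_def K_def)
  ultimately show ?thesis
    using IntB by (intro AE_I)
qed

section \<open>Recurrence of patterns\<close>

text \<open>Every counted occurrence comes from a recurrence vector \<open>y\<close>. With finitely
  many of these the counts would stay bounded while the cubes grow, so the frequency would tend to
  zero, against strict positivity.\<close>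

lemma infinite_recurrences:
  fixes D W :: "(int ^ 'd) set"
  assumes D: "strict_uniform_pattern_frequency D" and W: "finite W" "D \<inter> W \<noteq> {}"
  shows "infinite {y. \<forall>n\<in>W. n \<in> D \<longleftrightarrow> n - y \<in> D}"
proof
  let ?Y = "{y. \<forall>n\<in>W. n \<in> D \<longleftrightarrow> n - y \<in> D}"
  assume fin: "finite ?Y"
  let ?f = "\<lambda>L. pattern_freq D W 0 L"
  have "?f L \<le> 2 * real (card ?Y) / real L" if "L > 0" for L
  proof -
    let ?occ = "{Q'. Q' \<subseteq> D \<and>
      (\<exists>y \<in> (+) 0 ` cube 0 (real L). (+) y ` Q' = D \<inter> W \<and> Q' = D \<inter> (+) (- y) ` W)}"
    have "?occ \<subseteq> (\<lambda>y. D \<inter> (+) (- y) ` W) ` ?Y"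
    proof
      fix Q' assume "Q' \<in> ?occ"
      then obtain y where y: "(+) y ` Q' = D \<inter> W" "Q' = D \<inter> (+) (- y) ` W"
        by blast
      \<comment> \<open>The two equations for \<open>Q'\<close> together say that \<open>D\<close>
        and its translate agree on all of \<open>W\<close>, holes included: \<open>Q'\<close> is
        everything that \<open>D\<close> has in the translated window.\<close>
      have "n \<in> D \<longleftrightarrow> n - y \<in> D" if n: "n \<in> W" for n
      proof -
        have "n \<in> D \<longleftrightarrow> n \<in> (+) y ` Q'"
          using y(1) n by blast
        also have "\<dots> \<longleftrightarrow> n - y \<in> Q'"
          by (auto simp: image_iff intro: bexI[of _ "n - y"])
        also have "\<dots> \<longleftrightarrow> n - y \<in> D"
          using n by (subst y(2)) (auto simp: image_iff intro: bexI[of _ n])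
        finally show ?thesis .
      qed
      then show "Q' \<in> (\<lambda>y. D \<inter> (+) (- y) ` W) ` ?Y"
        using y(2) by blast
    qed
    then have "card ?occ \<le> card ?Y"
      using fin by (meson card_image_le card_mono finite_imageI order_trans)
    then have "?f L \<le> real (card ?Y) / (real L / 2)"
      unfolding pattern_freq_def using card_cube_0_ge[of L, where 'd = 'd] that
      by (intro frac_le) auto
    then show ?thesis
      by (simp add: mult.commute)
  qed
  then have upper: "eventually (\<lambda>L. ?f L \<le> 2 * real (card ?Y) / real L) sequentially"
    by (intro eventually_mono[OF eventually_gt_at_top[of 0]])
  have lower: "eventually (\<lambda>L. 0 \<le> ?f L) sequentially"
    by (simp add: pattern_freq_def)
  have "(\<lambda>L. 2 * real (card ?Y) / real L) \<longlonglongrightarrow> 0"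
    by (rule lim_const_over_n)
  then have "?f \<longlonglongrightarrow> 0"
    by (rule tendsto_sandwich[OF lower upper tendsto_const])
  then have "lim ?f = 0"
    by (rule limI)
  moreover have "0 < lim ?f"
    using D W unfolding strict_uniform_pattern_frequency_def by blast
  ultimately show False
    by simp
qed

theorem proposition3p2:
  fixes D :: "(int ^ 'd) set"
    and R M :: real
    and \<mu> :: "real measure"
    and P :: "'w measure"
    and \<omega> :: "int ^ 'd \<Rightarrow> 'w \<Rightarrow> real"
  assumes "M > 0"
    and "delone R D"
    and "prob_space P"
    and "real_distribution \<mu>"
    and "prob_space.indep_vars P (\<lambda>_. borel) \<omega> D"
    and "\<And>n. n \<in> D \<Longrightarrow> distr P borel (\<omega> n) = \<mu>"
    and "measure_support \<mu> \<subseteq> {0..M}"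
    and "0 \<in> measure_support \<mu>"
    and "strict_uniform_pattern_frequency D"
  shows "AE a in P. spectrum (H0 M D) \<subseteq> spectrum (H_random M D (\<lambda>n. \<omega> n a))"
proof -
  interpret P: prob_space P
    by fact
  interpret \<mu>: real_distribution \<mu>
    by fact
  have meas: "\<omega> n \<in> borel_measurable P" if "n \<in> D" for n
    using assms(5) that by (auto simp: P.indep_vars_def)
  have "AE a in P. \<exists>y. (\<forall>n\<in>cube 0 (real k). n \<in> D \<longleftrightarrow> n - y \<in> D) \<and>
      (\<forall>n\<in>cube 0 (real k) \<inter> D. \<bar>\<omega> (n - y) a\<bar> \<le> 1 / (real k + 1))" for k
  proof -
    \<comment> \<open>Side length at least \<open>R\<close> makes the window meet \<open>D\<close>
      by the Delone property, so its pattern is nonempty and has a positive frequency.\<close>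
    define W where "W = (cube 0 (max (real k) R) :: (int ^ 'd) set)"
    \<comment> \<open>An open interval around 0, so that
      \<open>0 \<in> measure_support \<mu>\<close> gives it positive measure.\<close>
    define U where "U = {- (1 / (real k + 1))<..<1 / (real k + 1)}"
    define Y where "Y = {y. \<forall>n\<in>W. n \<in> D \<longleftrightarrow> n - y \<in> D}"
    have sub: "cube 0 (real k) \<subseteq> W" "cube 0 R \<subseteq> W"
      unfolding W_def by (intro cube_0_mono; simp)+
    have W: "finite W" "D \<inter> W \<noteq> {}"
      using sub(2) assms(2) by (auto simp: W_def finite_cube_0 delone_def)
    have "0 \<in> U"
      by (simp add: U_def)
    then have "emeasure \<mu> U > 0"
      using assms(8) by (auto simp: measure_support_def U_def)
    then have p: "measure \<mu> U > 0"
      by (simp add: \<mu>.emeasure_eq_measure)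
    have "P.prob (\<omega> n -` U \<inter> space P) = measure \<mu> U" if "n \<in> D" for n
      using measure_distr[OF meas[OF that], of U] assms(6)[OF that] by (simp add: U_def)
    \<comment> \<open>Only sites of \<open>D\<close> carry random variables, so the translates are
      those of \<open>D \<inter> W\<close>; recurrence vectors keep them inside
      \<open>D\<close>.\<close>
    then have "AE a in P. \<exists>y\<in>Y. \<forall>n\<in>D \<inter> W. \<omega> (n - y) a \<in> U"
      using infinite_recurrences[OF assms(9) W] W p
      by (intro P.AE_translate_hits[OF assms(5)]) (auto simp: Y_def U_def)
    then show ?thesis
    proof (rule AE_mp, intro AE_I2 impI)
      fix a assume "\<exists>y\<in>Y. \<forall>n\<in>D \<inter> W. \<omega> (n - y) a \<in> U"
      then obtain y where y: "y \<in> Y" "\<And>n. n \<in> D \<inter> W \<Longrightarrow> \<omega> (n - y) a \<in> U"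
        by blast
      have "\<bar>\<omega> (n - y) a\<bar> \<le> 1 / (real k + 1)" if "n \<in> cube 0 (real k) \<inter> D" for n
      proof -
        have "\<omega> (n - y) a \<in> U"
          using that sub(1) by (intro y(2)) auto
        then show ?thesis
          by (auto simp: U_def)
      qed
      then show "\<exists>y. (\<forall>n\<in>cube 0 (real k). n \<in> D \<longleftrightarrow> n - y \<in> D) \<and>
          (\<forall>n\<in>cube 0 (real k) \<inter> D. \<bar>\<omega> (n - y) a\<bar> \<le> 1 / (real k + 1))"
        using y(1) sub(1) unfolding Y_def by blast
    qed
  qed
  then have "AE a in P. \<forall>k. \<exists>y. (\<forall>n\<in>cube 0 (real k). n \<in> D \<longleftrightarrow> n - y \<in> D) \<and>
      (\<forall>n\<in>cube 0 (real k) \<inter> D. \<bar>\<omega> (n - y) a\<bar> \<le> 1 / (real k + 1))"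
    by (simp add: AE_all_countable)
  then show ?thesis
  proof (rule AE_mp, intro AE_I2 impI)
    fix a assume "\<forall>k. \<exists>y. (\<forall>n\<in>cube 0 (real k). n \<in> D \<longleftrightarrow> n - y \<in> D) \<and>
      (\<forall>n\<in>cube 0 (real k) \<inter> D. \<bar>\<omega> (n - y) a\<bar> \<le> 1 / (real k + 1))"
    then show "spectrum (H0 M D) \<subseteq> spectrum (H_random M D (\<lambda>n. \<omega> n a))"
      by (intro spectrum_H0_subset) blast
  qed
qed

end
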